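(* Let $\mathcal U,\mathcal V$ be upper sets on $\omega$. Then $$\mathcal U\leq_{\mathrm{LT}}^{\mathsf o}\mathcal V\iff\mathcal U\leq_{\mathrm{LT}}f+\mathcal V\quad\text{for some } f\colon\omega\to\omega .$$
   Context: **Upper sets.** An upper set is a nonempty family $\mathcal U\subseteq\mathcal P(\omega)$, closed upwards under $\subseteq$, with $\emptyset\notin\mathcal U$. **Gamified Katětov order.** A tree is a subset $T\subseteq\omega^{<\omega}$ containing the empty string and closed under prefixes; $[T]$ is its set of infinite paths. $T$ is $\mathcal V$-branching if $\{n:\sigma^\frown n\in T\}\in\mathcal V$ for every $\sigma\in T$. A partial continuous function $\Phi\colon\subseteq\omega^\omega\to\omega$ is one determined by a partial function $\varphi\colon\subseteq\omega^{<\omega}\to\omega$ that is coherent (if $\sigma$ is a prefix of $\tau$ and both are in $\mathrm{dom}(\varphi)$ then $\varphi(\sigma)=\varphi(\tau)$) via: $\Phi(p)=c$ iff $\varphi(p\upharpoonright n)=c$ for some $n$. $\mathcal U\leq_{\mathrm{LT}}^{\mathsf o}\mathcal V$ iff there is a partial continuous $\Phi$ such that for every $A\in\mathcal U$ there is a $\mathcal V$-branching tree $T$ with $[T]\subseteq\mathrm{dom}(\Phi)$ and $\Phi(p)\in A$ for all $p\in[T]$. **Upper sequences.** An upper sequence is a family $\overline{\mathcal U}=(\mathcal U_n)_{n\in I}$ of upper sets with $I\subseteq\omega$. An upper set $\mathcal U$ is viewed as an upper sequence with a singleton index set (equivalently, as the constant sequence). A function $f\colon\omega\to\omega$ is viewed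 as the upper sequence whose $n$-th term is the principal ultrafilter $\{A\subseteq\omega:f(n)\in A\}$. Fix a computable bijection $\langle-,-\rangle\colon\omega^2\to\omega$. The sum $\overline{\mathcal U}+\overline{\mathcal V}$ of $(\mathcal U_i)_{i\in I}$ and $(\mathcal V_j)_{j\in J}$ is indexed by $\{\langle0,n\rangle:n\in I\}\cup\{\langle1,n\rangle:n\in J\}$, with terms $\mathcal U_n$ at $\langle0,n\rangle$ and $\mathcal V_n$ at $\langle1,n\rangle$. **LT-game and $\leq_{\mathrm{LT}}$.** For upper sequences $\overline{\mathcal U}=(\mathcal U_i)_{i\in I}$, $\overline{\mathcal V}=(\mathcal V_j)_{j\in J}$, the game $\mathfrak G(\overline{\mathcal U},\overline{\mathcal V})$ has players Merlin versus the team Arthur–Nimue. Merlin first chooses $x_0\in I$ and $A\in\mathcal U_{x_0}$. At round $n=0,1,\dots$ Arthur plays either $\langle1,u_n\rangle$, terminating the game with output $u_n$, or $\langle0,u_n\rangle$ with $u_n\in J$ (a query); after a query Nimue chooses $B_n\in\mathcal V_{u_n}$ and Merlin replies with $x_{n+1}\in B_n$. Arthur sees only $x_0,\dots,x_n$, and his strategy is a partial computable function $\omega^{<\omega}\rightharpoonup\omega$; Nimue sees the whole history and her strategy is arbitrary. The Arthur–Nimue strategy wins if every play following it terminates legally (after finitely many rounds) with output in $A$, or Merlin violates the rules first. $\overline{\mathcal U}\leq_{\mathrm{LT}}\overline{\mathcal V}$ iff Arthur–Nimue have a winning strategy in $\mathfrak G(\overline{\mathcal U},\overline{\mathcal V})$.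 *)

theory Defs
  imports Main "HOL-Library.Nat_Bijection" "HOL-Library.Sublist"
begin

section \<open>Partial computable functions\<close>

text \<open>
  Kleene's partial recursive functions, as terms that are evaluated on argument lists. Arities are
  not recorded in the terms: starting from an argument list of a fixed length, every subterm is only
  ever evaluated on lists of one length determined by the term, and an argument list of an
  inappropriate length makes the result undefined.
\<close>

datatype recf =
    Zero
  | Succ
  | Proj nat
  | Comp recf "recf list"
  | PrimRec recf recf
  | Mu recf

primrec rec_eval :: "recf \<Rightarrow> nat list \<Rightarrow> nat option" where
  "rec_eval Zero = (\<lambda>xs. Some 0)"
| "rec_eval Succ = (\<lambda>xs. case xs of [x] \<Rightarrow> Some (Suc x) | _ \<Rightarrow> None)"
| "rec_eval (Proj i) = (\<lambda>xs. if i < length xs then Some (xs ! i) else None)"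
| "rec_eval (Comp f gs) = (\<lambda>xs.
     let ys = map (\<lambda>e. e xs) (map rec_eval gs)
     in if None \<in> set ys then None else rec_eval f (map the ys))"
| "rec_eval (PrimRec f g) = (\<lambda>xs. case xs of
       [] \<Rightarrow> None
     | n # ys \<Rightarrow> rec_nat (rec_eval f ys)
                  (\<lambda>m r. Option.bind r (\<lambda>y. rec_eval g (m # y # ys))) n)"
| "rec_eval (Mu f) = (\<lambda>xs.
     if \<exists>n. rec_eval f (n # xs) = Some 0 \<and> (\<forall>m<n. rec_eval f (m # xs) \<noteq> None)
     then Some (LEAST n. rec_eval f (n # xs) = Some 0) else None)"

definition partial_computable :: "(nat list \<Rightarrow> nat option) \<Rightarrow> bool" where
  "partial_computable \<alpha> \<longleftrightarrow> (\<exists>r. \<forall>xs. \<alpha> xs = rec_eval r [list_encode xs])"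


section \<open>Upper sets and upper sequences\<close>

definition upper_set :: "nat set set \<Rightarrow> bool" where
  "upper_set U \<longleftrightarrow> U \<noteq> {} \<and> (\<forall>A\<in>U. \<forall>B. A \<subseteq> B \<longrightarrow> B \<in> U) \<and> {} \<notin> U"

text \<open>A sequence \<open>(U\<^sub>n)\<close> with \<open>n\<close> ranging over \<open>I \<subseteq> \<omega>\<close> is a partial map with domain \<open>I\<close>.\<close>

type_synonym set_seq = "nat \<Rightarrow> nat set set option"

definition upper_seq :: "set_seq \<Rightarrow> bool" where
  "upper_seq U \<longleftrightarrow> (\<forall>W\<in>ran U. upper_set W)"

definition single_seq :: "nat set set \<Rightarrow> set_seq" where
  "single_seq U = [0 \<mapsto> U]"

definition fun_seq :: "(nat \<Rightarrow> nat) \<Rightarrow> set_seq" where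
  "fun_seq f = (\<lambda>n. Some {A. f n \<in> A})"

text \<open>The pairing function is \<^const>\<open>prod_encode\<close>.\<close>

definition seq_sum :: "set_seq \<Rightarrow> set_seq \<Rightarrow> set_seq" where
  "seq_sum U V = (\<lambda>k. case prod_decode k of (i, n) \<Rightarrow>
     if i = 0 then U n else if i = 1 then V n else None)"

lemma upper_seq_single_seq: "upper_set U \<Longrightarrow> upper_seq (single_seq U)"
  by (simp add: upper_seq_def single_seq_def)

lemma upper_seq_fun_seq: "upper_seq (fun_seq f)"
  by (auto simp: upper_seq_def fun_seq_def upper_set_def ran_def)

lemma seq_sum_left: "seq_sum U V (prod_encode (0, n)) = U n"
  by (simp add: seq_sum_def)

lemma seq_sum_right: "seq_sum U V (prod_encode (1, n)) = V n"
  by (simp add: seq_sum_def)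

lemma dom_seq_sum:
  "dom (seq_sum U V) =
    {prod_encode (0, n) | n. n \<in> dom U} \<union> {prod_encode (1, n) | n. n \<in> dom V}"
proof (rule set_eqI)
  fix k
  obtain i n where k: "k = prod_encode (i, n)"
    by (metis prod_decode_inverse surj_pair)
  show "k \<in> dom (seq_sum U V) \<longleftrightarrow>
    k \<in> {prod_encode (0, n) | n. n \<in> dom U} \<union> {prod_encode (1, n) | n. n \<in> dom V}"
    by (auto simp: k seq_sum_def split: if_splits)
qed

lemma upper_seq_seq_sum:
  assumes "upper_seq U" and "upper_seq V"
  shows "upper_seq (seq_sum U V)"
  unfolding upper_seq_def
proof
  fix W
  assume "W \<in> ran (seq_sum U V)"
  then obtain k where k: "seq_sum U V k = Some W"
    by (auto simp: ran_def)
  obtain i n where "prod_decode k = (i, n)"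
    by (cases "prod_decode k")
  then have "U n = Some W \<or> V n = Some W"
    using k by (auto simp: seq_sum_def split: if_splits)
  then show "upper_set W"
    using assms by (auto simp: upper_seq_def intro: ranI)
qed


section \<open>The gamified Katetov order\<close>

definition is_tree :: "nat list set \<Rightarrow> bool" where
  "is_tree T \<longleftrightarrow> [] \<in> T \<and> (\<forall>\<tau>\<in>T. \<forall>\<sigma>. prefix \<sigma> \<tau> \<longrightarrow> \<sigma> \<in> T)"

definition restr :: "(nat \<Rightarrow> nat) \<Rightarrow> nat \<Rightarrow> nat list" where
  "restr p n = map p [0..<n]"

definition paths :: "nat list set \<Rightarrow> (nat \<Rightarrow> nat) set" where
  "paths T = {p. \<forall>n. restr p n \<in> T}"

definition branching :: "nat set set \<Rightarrow> nat list set \<Rightarrow> bool" where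
  "branching V T \<longleftrightarrow> (\<forall>\<sigma>\<in>T. {n. \<sigma> @ [n] \<in> T} \<in> V)"

definition coherent :: "(nat list \<Rightarrow> nat option) \<Rightarrow> bool" where
  "coherent \<phi> \<longleftrightarrow> (\<forall>\<sigma>\<in>dom \<phi>. \<forall>\<tau>\<in>dom \<phi>. prefix \<sigma> \<tau> \<longrightarrow> \<phi> \<sigma> = \<phi> \<tau>)"

definition partial_continuous :: "((nat \<Rightarrow> nat) \<Rightarrow> nat option) \<Rightarrow> bool" where
  "partial_continuous \<Phi> \<longleftrightarrow>
     (\<exists>\<phi>. coherent \<phi> \<and> (\<forall>p c. \<Phi> p = Some c \<longleftrightarrow> (\<exists>n. \<phi> (restr p n) = Some c)))"

definition LTo_le :: "nat set set \<Rightarrow> nat set set \<Rightarrow> bool" where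
  "LTo_le U V \<longleftrightarrow>
     (\<exists>\<Phi>. partial_continuous \<Phi> \<and>
       (\<forall>A\<in>U. \<exists>T. is_tree T \<and> branching V T \<and> paths T \<subseteq> dom \<Phi> \<and>
         (\<forall>p\<in>paths T. the (\<Phi> p) \<in> A)))"


section \<open>The LT-game\<close>

text \<open>
  A completed round \<open>(u, B, x)\<close> consists of Arthur's query \<open>u\<close>, Nimue's set \<open>B\<close> and Merlin's reply
  \<open>x\<close>. A position of the game, with Arthur to move, is given by Merlin's opening move \<open>(x\<^sub>0, A)\<close> and
  the list of the rounds completed so far, in chronological order.
\<close>

type_synonym round = "nat \<times> nat set \<times> nat"

type_synonym arthur = "nat list \<Rightarrow> nat option"

text \<open>Nimue sees Merlin's opening move, the completed rounds and Arthur's current query.\<close>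

type_synonym nimue = "nat \<Rightarrow> nat set \<Rightarrow> round list \<Rightarrow> nat \<Rightarrow> nat set"

definition arthur_view :: "nat \<Rightarrow> round list \<Rightarrow> nat list" where
  "arthur_view x0 h = x0 # map (\<lambda>(u, B, x). x) h"

definition legal_query :: "set_seq \<Rightarrow> nimue \<Rightarrow> nat \<Rightarrow> nat set \<Rightarrow> round list \<Rightarrow> nat \<Rightarrow> bool" where
  "legal_query V \<eta> x0 A h u \<longleftrightarrow> u \<in> dom V \<and> \<eta> x0 A h u \<in> the (V u)"

text \<open>
  The positions that can be reached when Arthur and Nimue follow the strategies \<open>\<alpha>\<close> and \<open>\<eta>\<close>
  and nobody has violated the rules.
\<close>

inductive reachable ::
  "set_seq \<Rightarrow> set_seq \<Rightarrow> arthur \<Rightarrow> nimue \<Rightarrow> nat \<Rightarrow> nat set \<Rightarrow> round list \<Rightarrow> bool"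
  for U V \<alpha> \<eta> where
  start: "x0 \<in> dom U \<Longrightarrow> A \<in> the (U x0) \<Longrightarrow> reachable U V \<alpha> \<eta> x0 A []"
| query: "reachable U V \<alpha> \<eta> x0 A h \<Longrightarrow>
    \<alpha> (arthur_view x0 h) = Some (prod_encode (0, u)) \<Longrightarrow>
    legal_query V \<eta> x0 A h u \<Longrightarrow>
    x \<in> \<eta> x0 A h u \<Longrightarrow>
    reachable U V \<alpha> \<eta> x0 A (h @ [(u, \<eta> x0 A h u, x)])"

text \<open>
  As a play in which Merlin breaks a rule first is won by Arthur and Nimue, only plays in which
  Merlin keeps to the rules matter. In those, each move of Arthur and Nimue must be legal, each
  output must lie in \<open>A\<close>, and the play must not go on forever.
\<close>

definition winning :: "set_seq \<Rightarrow> set_seq \<Rightarrow> arthur \<Rightarrow> nimue \<Rightarrow> bool" where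
  "winning U V \<alpha> \<eta> \<longleftrightarrow>
     (\<forall>x0 A h. reachable U V \<alpha> \<eta> x0 A h \<longrightarrow>
        (\<exists>u. \<alpha> (arthur_view x0 h) = Some (prod_encode (1, u)) \<and> u \<in> A) \<or>
        (\<exists>u. \<alpha> (arthur_view x0 h) = Some (prod_encode (0, u)) \<and> legal_query V \<eta> x0 A h u)) \<and>
     \<not> (\<exists>x0 A \<rho>. \<forall>n. reachable U V \<alpha> \<eta> x0 A (map \<rho> [0..<n]))"

definition LT_le :: "set_seq \<Rightarrow> set_seq \<Rightarrow> bool" where
  "LT_le U V \<longleftrightarrow> (\<exists>\<alpha> \<eta>. partial_computable \<alpha> \<and> winning U V \<alpha> \<eta>)"

end

theory Submission
  imports Defs
begin

text \<open>
  The two orders differ in how Arthur's strategy is given: by an arbitrary partial continuous map on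
  the replies from \<open>V\<close>, or by a partial computable function that may also query \<open>f\<close>. The function
  \<open>f\<close> is an oracle: a query \<open>k\<close> to it has the legal move \<open>{f k}\<close> for Nimue, and against that move Merlin
  must answer \<open>f k\<close>. The equivalence is thus the fact that a continuous map is one that is computable
  relative to an oracle.

  Suppose that \<open>\<phi>\<close> determines a continuous map reducing \<open>U\<close> to \<open>V\<close>. Put into \<open>f\<close>, at the code of
  Arthur's view, the move that \<open>\<phi>\<close> prescribes there: the output \<open>\<phi> \<sigma>\<close> if \<open>\<phi>\<close> is defined on the
  sequence \<open>\<sigma>\<close> of replies from \<open>V\<close>, and a query to \<open>V\<close> otherwise. Arthur alternates between asking
  \<open>f\<close> about his view and playing the answer. This strategy does not depend on \<open>\<phi>\<close>, and it is
  computable because it only needs the parity of the length and the last entry of a coded list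
  (\<open>partial_computable_alternating\<close>). Nimue answers the queries to \<open>V\<close> so that \<open>\<sigma>\<close> stays in the
  tree \<open>T\<close> belonging to \<open>A\<close>. An infinite play would follow a path of \<open>T\<close> outside the domain of the
  continuous map; and an output at \<open>\<sigma>\<close> lies in \<open>A\<close> because \<open>\<sigma>\<close> extends to a path of \<open>T\<close>
  (\<open>LTo_le_imp_LT_le\<close>).

  Conversely, given winning strategies, let the continuous map read a sequence and simulate Arthur,
  answering his queries to \<open>f\<close> by \<open>f\<close> and his queries to \<open>V\<close> by the next entry of the
  sequence. The simulation may run forever, which is why the map is partial. Since no play is
  infinite, bar induction on the positions of the game (\<open>play_induct\<close>) builds from Nimue's moves a \<open>V\<close>-branching tree along all paths of which the
  simulation ends with an output in \<open>A\<close> (\<open>LT_le_imp_LTo_le\<close>).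
\<close>

section \<open>Total recursive functions\<close>

text \<open>
  Only lists of the given length \<open>k\<close> matter. Closure of this predicate under composition and recursion
  replaces the construction of explicit terms of type \<^typ>\<open>recf\<close>.
\<close>

definition recursive :: "nat \<Rightarrow> (nat list \<Rightarrow> nat) \<Rightarrow> bool" where
  "recursive k f \<longleftrightarrow> (\<exists>r. \<forall>xs. length xs = k \<longrightarrow> rec_eval r xs = Some (f xs))"

lemma recursive_proj: "i < k \<Longrightarrow> recursive k (\<lambda>xs. xs ! i)"
  unfolding recursive_def by (rule exI[of _ "Proj i"]) simp

lemma recursive_zero: "recursive k (\<lambda>_. 0)"
  unfolding recursive_def by (rule exI[of _ Zero]) simp

lemma recursive_Suc:
  assumes "recursive k f"
  shows "recursive k (\<lambda>xs. Suc (f xs))"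
proof -
  obtain r where "\<forall>xs. length xs = k \<longrightarrow> rec_eval r xs = Some (f xs)"
    using assms unfolding recursive_def by blast
  then show ?thesis
    unfolding recursive_def by (intro exI[of _ "Comp Succ [r]"]) simp
qed

lemma recursive_comp1:
  assumes "recursive 1 (\<lambda>ys. g (ys ! 0))" and "recursive k f"
  shows "recursive k (\<lambda>xs. g (f xs))"
proof -
  obtain r s where "\<forall>ys. length ys = 1 \<longrightarrow> rec_eval r ys = Some (g (ys ! 0))"
    and "\<forall>xs. length xs = k \<longrightarrow> rec_eval s xs = Some (f xs)"
    using assms unfolding recursive_def by blast
  then show ?thesis
    unfolding recursive_def by (intro exI[of _ "Comp r [s]"]) simp
qed

lemma recursive_comp2:
  assumes "recursive 2 (\<lambda>ys. g (ys ! 0) (ys ! 1))" and "recursive k f1" and "recursive k f2"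
  shows "recursive k (\<lambda>xs. g (f1 xs) (f2 xs))"
proof -
  obtain r s1 s2 where "\<forall>ys. length ys = 2 \<longrightarrow> rec_eval r ys = Some (g (ys ! 0) (ys ! 1))"
    and "\<forall>xs. length xs = k \<longrightarrow> rec_eval s1 xs = Some (f1 xs)"
    and "\<forall>xs. length xs = k \<longrightarrow> rec_eval s2 xs = Some (f2 xs)"
    using assms unfolding recursive_def by blast
  then show ?thesis
    unfolding recursive_def by (intro exI[of _ "Comp r [s1, s2]"]) simp
qed

text \<open>
  The recursion equation is a hypothesis on an arbitrary \<open>h\<close>, so that the usual closed form of a
  function can be used directly.
\<close>

lemma recursive_rec_nat:
  assumes "recursive k f" and "recursive (Suc (Suc k)) g" and K: "K = Suc k"
    and h: "\<And>n ys. length ys = k \<Longrightarrow> h (n # ys) = rec_nat (f ys) (\<lambda>m y. g (m # y # ys)) n"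
  shows "recursive K h"
proof -
  obtain r s where r: "\<And>xs. length xs = k \<Longrightarrow> rec_eval r xs = Some (f xs)"
    and s: "\<And>xs. length xs = Suc (Suc k) \<Longrightarrow> rec_eval s xs = Some (g xs)"
    using assms unfolding recursive_def by blast
  have "rec_eval (PrimRec r s) (n # ys) = Some (rec_nat (f ys) (\<lambda>m y. g (m # y # ys)) n)"
    if "length ys = k" for n ys
    using that by (induction n) (simp_all add: r s)
  then show ?thesis
    unfolding recursive_def K
    by (intro exI[of _ "PrimRec r s"]) (auto simp del: rec_eval.simps simp: length_Suc_conv h)
qed

lemma recursive_Least:
  assumes "recursive (Suc k) f" and ex: "\<And>xs. length xs = k \<Longrightarrow> \<exists>n. f (n # xs) = 0"
  shows "recursive k (\<lambda>xs. LEAST n. f (n # xs) = 0)"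
proof -
  obtain r where "\<And>xs. length xs = Suc k \<Longrightarrow> rec_eval r xs = Some (f xs)"
    using assms unfolding recursive_def by blast
  then show ?thesis
    unfolding recursive_def using ex by (intro exI[of _ "Mu r"]) simp
qed

lemma recursive_if_zero:
  assumes "recursive k n" and "recursive k f" and "recursive k g"
  shows "recursive k (\<lambda>xs. if n xs = 0 then f xs else g xs)"
proof -
  have "recursive 3 (\<lambda>xs. if xs ! 0 = 0 then xs ! 1 else xs ! 2)"
  proof (rule recursive_rec_nat[of 2 "\<lambda>ys. ys ! 0" "\<lambda>xs. xs ! 3"])
    show "(if (n # ys) ! 0 = 0 then (n # ys) ! 1 else (n # ys) ! 2) =
        rec_nat (ys ! 0) (\<lambda>m y. (m # y # ys) ! 3) n" for n ys
      by (cases n) simp_all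
  qed (simp_all add: recursive_proj)
  then obtain r where
    r: "\<And>xs. length xs = 3 \<Longrightarrow> rec_eval r xs = Some (if xs ! 0 = 0 then xs ! 1 else xs ! 2)"
    unfolding recursive_def by blast
  obtain s1 s2 s3 where "\<forall>xs. length xs = k \<longrightarrow> rec_eval s1 xs = Some (n xs)"
    and "\<forall>xs. length xs = k \<longrightarrow> rec_eval s2 xs = Some (f xs)"
    and "\<forall>xs. length xs = k \<longrightarrow> rec_eval s3 xs = Some (g xs)"
    using assms unfolding recursive_def by blast
  then show ?thesis
    unfolding recursive_def by (intro exI[of _ "Comp r [s1, s2, s3]"]) (simp add: r)
qed

lemma recursive_funpow:
  assumes "recursive 1 (\<lambda>ys. g (ys ! 0))" and "recursive k n" and "recursive k f"
  shows "recursive k (\<lambda>xs. (g ^^ n xs) (f xs))"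
proof -
  have "recursive 2 (\<lambda>xs. (g ^^ (xs ! 0)) (xs ! 1))"
  proof (rule recursive_rec_nat[of 1 "\<lambda>ys. ys ! 0" "\<lambda>xs. g (xs ! 1)"])
    show "(g ^^ ((n # ys) ! 0)) ((n # ys) ! 1) =
        rec_nat (ys ! 0) (\<lambda>m y. g ((m # y # ys) ! 1)) n" for n ys
      by (induction n) simp_all
  qed (simp_all add: recursive_proj recursive_comp1[OF assms(1)])
  from recursive_comp2[of "\<lambda>a b. (g ^^ a) b", OF this assms(2,3)] show ?thesis .
qed

lemma recursive_add:
  assumes "recursive k f" and "recursive k g"
  shows "recursive k (\<lambda>xs. f xs + g xs)"
proof -
  have "recursive k (\<lambda>xs. (Suc ^^ f xs) (g xs))"
    by (intro recursive_funpow recursive_Suc recursive_proj assms) simp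
  then show ?thesis
    by (simp add: Suc_funpow)
qed

lemma recursive_pred:
  assumes "recursive k f"
  shows "recursive k (\<lambda>xs. f xs - 1)"
proof -
  have "recursive 1 (\<lambda>xs. xs ! 0 - 1)"
  proof (rule recursive_rec_nat[of 0 "\<lambda>_. 0" "\<lambda>xs. xs ! 0"])
    show "(n # ys) ! 0 - 1 = rec_nat 0 (\<lambda>m y. (m # y # ys) ! 0) n" for n ys
      by (cases n) simp_all
  qed (simp_all add: recursive_proj recursive_zero)
  from recursive_comp1[of "\<lambda>a. a - 1", OF this assms] show ?thesis .
qed

lemma recursive_diff:
  assumes "recursive k f" and "recursive k g"
  shows "recursive k (\<lambda>xs. f xs - g xs)"
proof -
  have "recursive k (\<lambda>xs. ((\<lambda>m. m - 1) ^^ g xs) (f xs))"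
    by (intro recursive_funpow recursive_pred recursive_proj assms) simp
  moreover have "((\<lambda>m. m - 1) ^^ b) a = a - b" for a b :: nat
    by (induction b) simp_all
  ultimately show ?thesis
    by simp
qed

section \<open>Computing with codes of pairs and finite sequences\<close>

lemma recursive_triangle:
  assumes "recursive k f"
  shows "recursive k (\<lambda>xs. triangle (f xs))"
proof -
  have "recursive 1 (\<lambda>xs. triangle (xs ! 0))"
  proof (rule recursive_rec_nat[of 0 "\<lambda>_. 0" "\<lambda>xs. xs ! 1 + Suc (xs ! 0)"])
    show "triangle ((n # ys) ! 0) = rec_nat 0 (\<lambda>m y. (m # y # ys) ! 1 + Suc ((m # y # ys) ! 0)) n"
      for n ys
      by (induction n) simp_all
    show "recursive (Suc (Suc 0)) (\<lambda>xs. xs ! 1 + Suc (xs ! 0))"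
      by (intro recursive_add recursive_Suc recursive_proj) simp_all
  qed (simp_all add: recursive_zero)
  from recursive_comp1[OF this assms] show ?thesis .
qed

text \<open>
  Since \<open>prod_encode (a, b) = triangle (a + b) + a\<close>, the diagonal \<open>a + b\<close> of a pair is the largest \<open>n\<close> for
  which \<open>triangle n\<close> is at most its code. Written as a least zero, it can be found by unbounded search,
  and both components are obtained from it by subtraction.
\<close>

definition diagonal :: "nat \<Rightarrow> nat" where
  "diagonal z = (LEAST n. Suc z - triangle (Suc n) = 0)"

lemma diagonal_prod_encode: "diagonal (prod_encode (a, b)) = a + b"
  unfolding diagonal_def
proof (rule Least_equality)
  show "Suc (prod_encode (a, b)) - triangle (Suc (a + b)) = 0"
    by (simp add: prod_encode_def)
  fix n
  assume n: "Suc (prod_encode (a, b)) - triangle (Suc n) = 0"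
  show "a + b \<le> n"
  proof (rule ccontr)
    assume "\<not> a + b \<le> n"
    moreover have "mono triangle"
      by (simp add: mono_iff_le_Suc)
    ultimately have "triangle (Suc n) \<le> triangle (a + b)"
      by (intro monoD[of triangle]) simp_all
    with n show False
      by (simp add: prod_encode_def)
  qed
qed

lemma recursive_diagonal:
  assumes "recursive k f"
  shows "recursive k (\<lambda>xs. diagonal (f xs))"
proof -
  have "recursive 1 (\<lambda>xs. LEAST n. Suc ((n # xs) ! 1) - triangle (Suc ((n # xs) ! 0)) = 0)"
  proof (rule recursive_Least)
    show "recursive (Suc 1) (\<lambda>xs. Suc (xs ! 1) - triangle (Suc (xs ! 0)))"
      by (intro recursive_diff recursive_Suc recursive_triangle recursive_proj) simp_all
    fix xs :: "nat list"
    have "z \<le> triangle z" for z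
      by (induction z) simp_all
    then show "\<exists>n. Suc ((n # xs) ! 1) - triangle (Suc ((n # xs) ! 0)) = 0"
      by (intro exI[of _ "xs ! 0"]) simp
  qed
  then have "recursive 1 (\<lambda>xs. diagonal (xs ! 0))"
    by (simp add: diagonal_def)
  from recursive_comp1[OF this assms] show ?thesis .
qed

lemma fst_prod_decode: "fst (prod_decode z) = z - triangle (diagonal z)"
proof -
  obtain a b where "z = prod_encode (a, b)"
    by (metis prod_decode_inverse surj_pair)
  then show ?thesis
    by (simp add: diagonal_prod_encode) (simp add: prod_encode_def)
qed

lemma snd_prod_decode: "snd (prod_decode z) = diagonal z - fst (prod_decode z)"
proof -
  obtain a b where "z = prod_encode (a, b)"
    by (metis prod_decode_inverse surj_pair)
  then show ?thesis
    by (simp add: diagonal_prod_encode)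
qed

lemma recursive_fst_prod_decode:
  assumes "recursive k f"
  shows "recursive k (\<lambda>xs. fst (prod_decode (f xs)))"
  unfolding fst_prod_decode
  by (intro recursive_diff recursive_triangle recursive_diagonal assms)

lemma recursive_snd_prod_decode:
  assumes "recursive k f"
  shows "recursive k (\<lambda>xs. snd (prod_decode (f xs)))"
  unfolding snd_prod_decode
  by (intro recursive_diff recursive_diagonal recursive_fst_prod_decode assms)

definition code_hd :: "nat \<Rightarrow> nat" where
  "code_hd c = fst (prod_decode (c - 1))"

definition code_tl :: "nat \<Rightarrow> nat" where
  "code_tl c = snd (prod_decode (c - 1))"

lemma code_hd_list_encode: "code_hd (list_encode (x # xs)) = x"
  by (simp add: code_hd_def)

text \<open>
  The empty list is no exception: its code \<open>0\<close> has the truncated predecessor \<open>0\<close>, which codes the pair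
  \<open>(0, 0)\<close>.
\<close>

lemma code_tl_list_encode: "code_tl (list_encode xs) = list_encode (tl xs)"
proof (cases xs)
  case Nil
  have "prod_encode (0, 0) = 0"
    by (simp add: prod_encode_def)
  then have "prod_decode 0 = (0, 0)"
    by (metis prod_encode_inverse)
  with Nil show ?thesis
    by (simp add: code_tl_def)
qed (simp add: code_tl_def)

lemma list_encode_eq_0: "list_encode xs = 0 \<longleftrightarrow> xs = []"
  by (cases xs) simp_all

lemma length_le_list_encode: "length xs \<le> list_encode xs"
proof (induction xs)
  case (Cons x xs)
  then show ?case
    using le_prod_encode_2[of "list_encode xs" x] by simp
qed simp

text \<open>
  The test keeps the last one or two entries of a list. Iterating the function therefore ends in a list
  of length \<open>1\<close> or \<open>2\<close> that shows both the parity of the original length and the original last entry.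
\<close>

definition code_drop2 :: "nat \<Rightarrow> nat" where
  "code_drop2 c = (if code_tl (code_tl c) = 0 then c else code_tl (code_tl c))"

lemma code_drop2_list_encode:
  "code_drop2 (list_encode xs) = list_encode (if length xs \<le> 2 then xs else drop 2 xs)"
proof -
  have "tl (tl xs) = drop 2 xs"
    by (simp add: drop_Suc numeral_2_eq_2)
  then show ?thesis
    by (simp add: code_drop2_def code_tl_list_encode list_encode_eq_0)
qed

lemma funpow_code_drop2:
  "length xs \<le> n \<Longrightarrow>
    (code_drop2 ^^ n) (list_encode xs) = list_encode (drop (2 * ((length xs - 1) div 2)) xs)"
proof (induction n arbitrary: xs)
  case (Suc n)
  show ?case
  proof (cases "length xs \<le> 2")
    case True
    then have "(length xs - 1) div 2 = 0"
      by auto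
    moreover have "(code_drop2 ^^ m) (list_encode xs) = list_encode xs" for m
      using True by (induction m) (simp_all add: code_drop2_list_encode)
    ultimately show ?thesis
      by (metis drop0 mult_0_right)
  next
    case False
    then obtain d where "length xs = d + 3"
      using le_Suc_ex[of 3 "length xs"] by (auto simp: add.commute)
    then have "2 * ((length xs - 1) div 2) = 2 * ((length (drop 2 xs) - 1) div 2) + 2"
      by simp
    with False Suc show ?thesis
      by (simp add: funpow_swap1 code_drop2_list_encode)
  qed
qed simp


section \<open>Arthur's alternating strategy\<close>

text \<open>
  At a view of odd length Arthur asks the oracle about the whole view; otherwise the last entry is the
  oracle's answer, and he plays it as his move. The empty view does not occur in the game; its value is
  the one that the evaluation by \<open>alternating_code\<close> below gives.
\<close>

definition alternating :: "nat list \<Rightarrow> nat option" where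
  "alternating xs = Some (if xs = [] \<or> odd (length xs)
     then prod_encode (0, prod_encode (0, list_encode xs)) else last xs)"

text \<open>
  The code of a list bounds its length, so \<open>c\<close> iterations are enough. The term
  \<open>triangle (triangle c)\<close> is \<open>prod_encode (0, prod_encode (0, c))\<close>, the query \<open>c\<close> to the oracle.
\<close>

definition alternating_code :: "nat \<Rightarrow> nat" where
  "alternating_code c = (let s = (code_drop2 ^^ c) c in
     if code_tl s = 0 then triangle (triangle c) else code_hd (code_tl s))"

lemma alternating_code_list_encode: "alternating xs = Some (alternating_code (list_encode xs))"
proof -
  define k where "k = 2 * ((length xs - 1) div 2)"
  have s: "(code_drop2 ^^ list_encode xs) (list_encode xs) = list_encode (drop k xs)"
    unfolding k_def by (rule funpow_code_drop2[OF length_le_list_encode])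
  show ?thesis
  proof (cases "xs = [] \<or> odd (length xs)")
    case True
    then have "length xs - k \<le> 1"
      by (auto simp: k_def elim: oddE)
    then have "tl (drop k xs) = []"
      by (metis length_0_conv length_tl length_drop diff_is_0_eq)
    with True show ?thesis
      by (simp add: alternating_def alternating_code_def s code_tl_list_encode list_encode_eq_0
          prod_encode_def)
  next
    case False
    then obtain m where m: "length xs = 2 * m"
      by (auto elim: evenE)
    with False have "m \<noteq> 0"
      by (cases m) auto
    with m have "length xs = k + 2"
      by (cases m) (simp_all add: k_def)
    then have "length (drop k xs) = 2"
      by simp
    then obtain a b where ab: "drop k xs = [a, b]"
      by (auto simp: length_Suc_conv numeral_2_eq_2 simp del: length_drop)
    then have "last xs = b"
      using \<open>length xs = k + 2\<close> last_drop[of k xs] by simp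
    with False ab show ?thesis
      by (simp add: alternating_def alternating_code_def s code_tl_list_encode list_encode_eq_0
          code_hd_list_encode del: list_encode.simps)
  qed
qed

lemma partial_computable_alternating: "partial_computable alternating"
proof -
  have hd: "recursive k (\<lambda>xs. code_hd (f xs))" and tl: "recursive k (\<lambda>xs. code_tl (f xs))"
    if "recursive k f" for k f
    unfolding code_hd_def code_tl_def
    by (intro recursive_fst_prod_decode recursive_snd_prod_decode recursive_pred that)+
  have x: "recursive 1 (\<lambda>ys. ys ! 0)"
    by (rule recursive_proj) simp
  have d: "recursive 1 (\<lambda>ys. code_drop2 (ys ! 0))"
    unfolding code_drop2_def by (intro recursive_if_zero tl x)
  have "recursive 1 (\<lambda>ys. alternating_code (ys ! 0))"
    unfolding alternating_code_def Let_def
    by (intro recursive_if_zero tl hd recursive_triangle recursive_funpow[OF d] x)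
  then show ?thesis
    unfolding recursive_def partial_computable_def alternating_code_list_encode
    by (metis One_nat_def length_Cons list.size(3) nth_Cons_0)
qed


section \<open>From continuous maps to the game\<close>

text \<open>
  After Merlin's opening move, the oracle's answers alternate with the replies from \<open>V\<close>, beginning with
  an answer. So the entries in second, fourth, ... place are the replies from \<open>V\<close>.
\<close>

fun every_second :: "nat list \<Rightarrow> nat list" where
  "every_second (x # y # zs) = y # every_second zs"
| "every_second _ = []"

lemma every_second_snoc:
  "every_second (xs @ [x]) = every_second xs @ (if odd (length xs) then [x] else [])"
  by (induction xs rule: every_second.induct) simp_all

lemma every_second_map_upt:
  "every_second (map g [0..<2 * n]) = restr (\<lambda>i. g (Suc (2 * i))) n"
proof (induction n)
  case (Suc n)
  have "map g [0..<2 * Suc n] = (map g [0..<2 * n] @ [g (2 * n)]) @ [g (Suc (2 * n))]"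
    by simp
  with Suc show ?case
    by (simp only: every_second_snoc) (simp add: restr_def)
qed (simp add: restr_def)

definition reply :: "round \<Rightarrow> nat" where
  "reply r = snd (snd r)"

lemma reply_simp [simp]: "reply (u, B, x) = x"
  by (simp add: reply_def)

lemma arthur_view_eq: "arthur_view x0 h = x0 # map reply h"
  by (auto simp: arthur_view_def reply_def)

definition query_V :: nat where
  "query_V = prod_encode (0, prod_encode (1, 0))"

text \<open>
  The oracle's answer is the code of Arthur's next move. The tail removes Merlin's opening move from
  the view.
\<close>

definition oracle_fun :: "(nat list \<Rightarrow> nat option) \<Rightarrow> nat \<Rightarrow> nat" where
  "oracle_fun \<phi> c = (case \<phi> (every_second (tl (list_decode c))) of
     Some u \<Rightarrow> prod_encode (1, u) | None \<Rightarrow> query_V)"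

definition tree_nimue :: "(nat \<Rightarrow> nat) \<Rightarrow> (nat set \<Rightarrow> nat list set) \<Rightarrow> nimue" where
  "tree_nimue f S x0 A h u = (case prod_decode u of (i, c) \<Rightarrow>
     if i = 0 then {f c} else {n. every_second (map reply h) @ [n] \<in> S A})"

text \<open>
  No set of children is empty, so children can be chosen forever.
\<close>

lemma tree_extends_to_path:
  assumes "branching V T" and "{} \<notin> V" and "\<sigma> \<in> T" and "is_tree T"
  obtains p where "p \<in> paths T" and "restr p (length \<sigma>) = \<sigma>"
proof -
  define s where "s = rec_nat \<sigma> (\<lambda>_ \<tau>. \<tau> @ [SOME n. \<tau> @ [n] \<in> T])"
  have s0: "s 0 = \<sigma>" and sS: "\<And>k. s (Suc k) = s k @ [SOME n. s k @ [n] \<in> T]"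
    by (simp_all add: s_def)
  have ex: "\<exists>n. \<tau> @ [n] \<in> T" if "\<tau> \<in> T" for \<tau>
  proof -
    have "{n. \<tau> @ [n] \<in> T} \<noteq> {}"
      using assms that unfolding branching_def by metis
    then show ?thesis
      by blast
  qed
  have sT: "s k \<in> T" for k
    by (induction k) (use assms s0 sS ex in \<open>auto intro: someI_ex\<close>)
  have len: "length (s k) = length \<sigma> + k" for k
    by (induction k) (simp_all add: s0 sS)
  define p where "p i = s (Suc i) ! i" for i
  have pre: "prefix (s j) (s (j + d))" for j d
    by (induction d) (auto simp: sS intro: prefix_order.trans)
  have nth: "p i = s k ! i" if "i < length (s k)" for i k
  proof (cases "Suc i \<le> k")
    case True
    then obtain d where "k = Suc i + d"
      using le_Suc_ex by blast
    with pre[of "Suc i" d] show ?thesis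
      unfolding p_def prefix_def using len[of "Suc i"] by (auto simp: nth_append)
  next
    case False
    then obtain d where "Suc i = k + d"
      using le_Suc_ex by (metis nat_le_linear)
    with pre[of k d] that show ?thesis
      unfolding p_def prefix_def by (auto simp: nth_append)
  qed
  have take: "restr p n = take n (s k)" if "n \<le> length (s k)" for n k
    using that by (auto simp: restr_def list_eq_iff_nth_eq nth)
  show thesis
  proof
    show "restr p (length \<sigma>) = \<sigma>"
      using take[of "length \<sigma>" 0] by (simp add: s0)
    have "restr p n \<in> T" for n
      using take[of n n] len[of n] sT[of n] assms(4) take_is_prefix
      unfolding is_tree_def by (metis le_add2)
    then show "p \<in> paths T"
      by (simp add: paths_def)
  qed
qed

lemma reachable_snocD:
  assumes "reachable U V \<alpha> \<eta> x0 A (h @ [r])"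
  shows "reachable U V \<alpha> \<eta> x0 A h"
    and "\<exists>u. \<alpha> (arthur_view x0 h) = Some (prod_encode (0, u)) \<and> legal_query V \<eta> x0 A h u \<and>
      r = (u, \<eta> x0 A h u, reply r) \<and> reply r \<in> \<eta> x0 A h u"
  using assms by (cases; auto simp: reply_def)+

lemma LTo_le_imp_LT_le:
  assumes V: "upper_set V" and le: "LTo_le U V"
  shows "\<exists>f. LT_le (single_seq U) (seq_sum (fun_seq f) (single_seq V))"
proof -
  obtain \<Phi> \<phi> where \<Phi>: "\<And>p c. \<Phi> p = Some c \<longleftrightarrow> (\<exists>n. \<phi> (restr p n) = Some c)"
    and "\<forall>A\<in>U. \<exists>T. is_tree T \<and> branching V T \<and> paths T \<subseteq> dom \<Phi> \<and>
         (\<forall>p\<in>paths T. the (\<Phi> p) \<in> A)"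
    using le unfolding LTo_le_def partial_continuous_def by blast
  then obtain S where S: "\<And>A. A \<in> U \<Longrightarrow> is_tree (S A) \<and> branching V (S A) \<and>
      paths (S A) \<subseteq> dom \<Phi> \<and> (\<forall>p\<in>paths (S A). the (\<Phi> p) \<in> A)"
    by metis
  define f where "f = oracle_fun \<phi>"
  define \<eta> where "\<eta> = tree_nimue f S"
  define W where "W = seq_sum (fun_seq f) (single_seq V)"
  let ?R = "reachable (single_seq U) W alternating \<eta>"

  have even_move: "alternating (arthur_view x0 h) =
      Some (prod_encode (0, prod_encode (0, list_encode (x0 # map reply h))))"
    if "even (length h)" for x0 h
    using that by (simp add: alternating_def arthur_view_eq del: list_encode.simps)
  have odd_move: "alternating (arthur_view x0 h) = Some (reply (last h))" if "odd (length h)" for x0 h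
  proof -
    have "h \<noteq> []"
      using that by auto
    with that show ?thesis
      by (simp add: alternating_def arthur_view_eq last_map)
  qed
  have \<eta>_f: "\<eta> x0 A h (prod_encode (0, c)) = {f c}" for x0 A h c
    by (simp add: \<eta>_def tree_nimue_def)
  have \<eta>_V: "\<eta> x0 A h (prod_encode (1, 0)) = {n. every_second (map reply h) @ [n] \<in> S A}" for x0 A h
    by (simp add: \<eta>_def tree_nimue_def)
  have legal_f: "legal_query W \<eta> x0 A h (prod_encode (0, c))" for x0 A h c
    by (simp add: legal_query_def W_def seq_sum_left fun_seq_def \<eta>_f dom_def)
  have legal_V: "legal_query W \<eta> x0 A h (prod_encode (1, 0))"
    if "A \<in> U" and "every_second (map reply h) \<in> S A" for x0 A h
  proof -
    have "W (prod_encode (1, 0)) = Some V"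
      by (simp only: W_def seq_sum_right single_seq_def fun_upd_same)
    moreover have "{n. every_second (map reply h) @ [n] \<in> S A} \<in> V"
      using S[OF that(1)] that(2) by (simp add: branching_def)
    ultimately show ?thesis
      by (simp only: legal_query_def \<eta>_V dom_def) simp
  qed
  have f_code: "f (list_encode (x0 # xs)) =
      (case \<phi> (every_second xs) of Some u \<Rightarrow> prod_encode (1, u) | None \<Rightarrow> query_V)" for x0 xs
    by (simp add: f_def oracle_fun_def del: list_encode.simps)

  \<comment> \<open>The replies from \<open>V\<close> stay in the tree. If the last round was a query to the oracle, then its
    answer is what \<open>\<phi>\<close> prescribes at the current sequence of these replies.\<close>
  have inv: "A \<in> U \<and> every_second (map reply h) \<in> S A \<and>
      (odd (length h) \<longrightarrow> reply (last h) = (case \<phi> (every_second (map reply h)) of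
         Some u \<Rightarrow> prod_encode (1, u) | None \<Rightarrow> query_V))"
    if "?R x0 A h" for x0 A h
    using that
  proof induction
    case (start x0 A)
    then have "A \<in> U"
      by (auto simp: single_seq_def split: if_splits)
    with S show ?case
      by (auto simp: is_tree_def)
  next
    case (query x0 A h u x)
    show ?case
    proof (cases "even (length h)")
      case True
      then have "u = prod_encode (0, list_encode (x0 # map reply h))"
        using query.hyps(2) even_move by (simp del: list_encode.simps)
      then have "x = f (list_encode (x0 # map reply h))"
        using query.hyps(4) \<eta>_f by (simp del: list_encode.simps)
      then show ?thesis
        using query.IH True by (simp add: every_second_snoc f_code del: list_encode.simps)
    next
      case False
      then have "\<phi> (every_second (map reply h)) = None" and "u = prod_encode (1, 0)"
        using query.hyps(2) query.IH odd_move by (auto simp: query_V_def split: option.splits)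
      then show ?thesis
        using query.hyps(4) query.IH \<eta>_V False
        by (simp add: every_second_snoc)
    qed
  qed

  have "winning (single_seq U) W alternating \<eta>"
    unfolding winning_def
  proof (intro conjI allI impI notI)
    fix x0 A h
    assume R: "?R x0 A h"
    let ?\<sigma> = "every_second (map reply h)"
    show "(\<exists>u. alternating (arthur_view x0 h) = Some (prod_encode (1, u)) \<and> u \<in> A) \<or>
        (\<exists>u. alternating (arthur_view x0 h) = Some (prod_encode (0, u)) \<and>
          legal_query W \<eta> x0 A h u)"
    proof (cases "even (length h)")
      case True
      then show ?thesis
        using even_move legal_f by blast
    next
      case False
      note * = inv[OF R]
      show ?thesis
      proof (cases "\<phi> ?\<sigma>")
        case None
        with False * have "alternating (arthur_view x0 h) = Some (prod_encode (0, prod_encode (1, 0)))"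
          by (simp add: odd_move query_V_def)
        with * legal_V show ?thesis
          by blast
      next
        \<comment> \<open>A path of the tree through the replies seen so far has the output as its value.\<close>
        case (Some u)
        with False * have out: "alternating (arthur_view x0 h) = Some (prod_encode (1, u))"
          by (simp add: odd_move)
        obtain p where p: "p \<in> paths (S A)" "restr p (length ?\<sigma>) = ?\<sigma>"
          using tree_extends_to_path[of V "S A" ?\<sigma>] S[of A] * V by (auto simp: upper_set_def)
        then have "\<Phi> p = Some u"
          using \<Phi> Some by metis
        with p S[of A] * have "u \<in> A"
          by fastforce
        with out show ?thesis
          by blast
      qed
    qed
  next
    assume "\<exists>x0 A \<rho>. \<forall>n. ?R x0 A (map \<rho> [0..<n])"
    then obtain x0 A \<rho> where R: "\<And>n. ?R x0 A (map \<rho> [0..<n])"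
      by blast
    \<comment> \<open>Round \<open>2 * i\<close> is the query to the oracle before the \<open>i\<close>-th query to \<open>V\<close>.\<close>
    define p where "p i = reply (\<rho> (Suc (2 * i)))" for i
    have \<sigma>: "every_second (map reply (map \<rho> [0..<2 * n])) = restr p n" for n
      using every_second_map_upt[of "\<lambda>i. reply (\<rho> i)" n] by (simp add: p_def[abs_def] comp_def)
    have "p \<in> paths (S A)"
      unfolding paths_def using inv[OF R] \<sigma>[symmetric] by simp
    moreover have "A \<in> U"
      using inv[OF R] by blast
    ultimately obtain c where "\<Phi> p = Some c"
      using S by blast
    then obtain n where n: "\<phi> (restr p n) = Some c"
      using \<Phi> by blast
    \<comment> \<open>After the next oracle query Arthur must output \<open>c\<close>, but the play goes on.\<close>
    let ?h = "map \<rho> [0..<Suc (2 * n)]"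
    have "every_second (map reply ?h) = restr p n"
      using \<sigma>[of n] by (simp add: every_second_snoc)
    then have "alternating (arthur_view x0 ?h) = Some (prod_encode (1, c))"
      using inv[OF R[of "Suc (2 * n)"]] n odd_move[of ?h] by simp
    moreover have "?R x0 A (?h @ [\<rho> (Suc (2 * n))])"
      using R[of "Suc (Suc (2 * n))"] by simp
    ultimately show False
      using reachable_snocD(2) by fastforce
  qed
  then show ?thesis
    unfolding LT_le_def W_def using partial_computable_alternating by blast
qed


section \<open>From the game to continuous maps\<close>

text \<open>
  \<open>simulate \<alpha> f xs \<sigma> c\<close>: from the view \<open>xs\<close>, Arthur comes to output \<open>c\<close> if his queries to \<open>f\<close> are
  answered by \<open>f\<close> and those to \<open>V\<close> by the successive entries of \<open>\<sigma>\<close>. Entries may be left over, so the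
  relation passes to extensions of \<open>\<sigma>\<close>; a least fixed point gives no output to simulations that
  never end.
\<close>

inductive simulate :: "arthur \<Rightarrow> (nat \<Rightarrow> nat) \<Rightarrow> nat list \<Rightarrow> nat list \<Rightarrow> nat \<Rightarrow> bool"
  for \<alpha> f where
  answer: "\<alpha> xs = Some (prod_encode (1, c)) \<Longrightarrow> simulate \<alpha> f xs \<sigma> c"
| query_f: "\<alpha> xs = Some (prod_encode (0, prod_encode (0, k))) \<Longrightarrow>
    simulate \<alpha> f (xs @ [f k]) \<sigma> c \<Longrightarrow> simulate \<alpha> f xs \<sigma> c"
| query_V: "\<alpha> xs = Some (prod_encode (0, prod_encode (1, j))) \<Longrightarrow>
    simulate \<alpha> f (xs @ [n]) \<sigma> c \<Longrightarrow> simulate \<alpha> f xs (n # \<sigma>) c"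

lemma simulate_prefix_unique:
  "simulate \<alpha> f xs \<sigma> c \<Longrightarrow> simulate \<alpha> f xs \<tau> d \<Longrightarrow> prefix \<sigma> \<tau> \<Longrightarrow> c = d"
proof (induction arbitrary: \<tau> rule: simulate.induct)
  case (answer xs c \<sigma>)
  from answer(2,1) show ?case
    by cases auto
next
  case (query_f xs k \<sigma> c)
  from query_f(4,1) have "simulate \<alpha> f (xs @ [f k]) \<tau> d"
    by cases auto
  with query_f show ?case
    by blast
next
  case (query_V xs j n \<sigma> c)
  from query_V(5) obtain \<tau>' where \<tau>': "\<tau> = n # \<tau>'" "prefix \<sigma> \<tau>'"
    by (cases \<tau>) auto
  from query_V(4,1) \<tau>' have "simulate \<alpha> f (xs @ [n]) \<tau>' d"
    by cases auto
  with query_V \<tau>' show ?case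
    by blast
qed

definition simulation_map :: "arthur \<Rightarrow> (nat \<Rightarrow> nat) \<Rightarrow> (nat \<Rightarrow> nat) \<Rightarrow> nat option" where
  "simulation_map \<alpha> f p = (if \<exists>c n. simulate \<alpha> f [0] (restr p n) c
     then Some (SOME c. \<exists>n. simulate \<alpha> f [0] (restr p n) c) else None)"

lemma prefix_restr: "m \<le> n \<Longrightarrow> prefix (restr p m) (restr p n)"
  by (metis restr_def le_add_diff_inverse map_append prefixI upt_add_eq_append zero_le)

lemma simulation_map_eq_Some:
  "simulation_map \<alpha> f p = Some c \<longleftrightarrow> (\<exists>n. simulate \<alpha> f [0] (restr p n) c)"
proof -
  have "c = d" if "simulate \<alpha> f [0] (restr p n) c" and "simulate \<alpha> f [0] (restr p m) d" for c d m n
    using that simulate_prefix_unique prefix_restr by (metis nat_le_linear)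
  then have "(SOME d. \<exists>n. simulate \<alpha> f [0] (restr p n) d) = c"
    if "simulate \<alpha> f [0] (restr p n) c" for c n
    using that by (intro some_equality) blast+
  then show ?thesis
    unfolding simulation_map_def by auto
qed

lemma partial_continuous_simulation_map: "partial_continuous (simulation_map \<alpha> f)"
proof -
  define \<phi> where "\<phi> \<sigma> = (if \<exists>c. simulate \<alpha> f [0] \<sigma> c
     then Some (SOME c. simulate \<alpha> f [0] \<sigma> c) else None)" for \<sigma>
  have \<phi>: "\<phi> \<sigma> = Some c \<longleftrightarrow> simulate \<alpha> f [0] \<sigma> c" for \<sigma> c
  proof -
    have "(SOME d. simulate \<alpha> f [0] \<sigma> d) = c" if "simulate \<alpha> f [0] \<sigma> c" for c
      using that by (intro some_equality) (auto dest: simulate_prefix_unique)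
    then show ?thesis
      unfolding \<phi>_def by auto
  qed
  have "coherent \<phi>"
    unfolding coherent_def
  proof (intro ballI impI)
    fix \<sigma> \<tau>
    assume "\<sigma> \<in> dom \<phi>" and "\<tau> \<in> dom \<phi>" and "prefix \<sigma> \<tau>"
    then show "\<phi> \<sigma> = \<phi> \<tau>"
      using simulate_prefix_unique \<phi> by (metis domD)
  qed
  then show ?thesis
    unfolding partial_continuous_def using \<phi> simulation_map_eq_Some by blast
qed

text \<open>
  Bar induction: if \<open>P\<close> failed at the start, it would fail at some continuation of every position at
  which it fails, and following these continuations would give an infinite play.
\<close>

lemma play_induct:
  assumes start: "reachable U V \<alpha> \<eta> x0 A []"
    and finite: "\<not> (\<exists>\<rho>. \<forall>n. reachable U V \<alpha> \<eta> x0 A (map \<rho> [0..<n]))"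
    and step: "\<And>h. reachable U V \<alpha> \<eta> x0 A h \<Longrightarrow>
      (\<And>r. reachable U V \<alpha> \<eta> x0 A (h @ [r]) \<Longrightarrow> P (h @ [r])) \<Longrightarrow> P h"
  shows "P []"
proof (rule ccontr)
  assume "\<not> P []"
  define bad where "bad h \<longleftrightarrow> reachable U V \<alpha> \<eta> x0 A h \<and> \<not> P h" for h
  define s where "s = rec_nat [] (\<lambda>_ h. h @ [SOME r. bad (h @ [r])])"
  have s: "s 0 = []" "\<And>n. s (Suc n) = s n @ [SOME r. bad (s n @ [r])]"
    by (simp_all add: s_def)
  have "\<exists>r. bad (h @ [r])" if "bad h" for h
    using that step unfolding bad_def by blast
  then have "bad (s n)" for n
    by (induction n) (use \<open>\<not> P []\<close> start s in \<open>auto simp: bad_def[of "[]"] intro: someI_ex\<close>)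
  moreover define \<rho> where "\<rho> n = (SOME r. bad (s n @ [r]))" for n
  then have "map \<rho> [0..<n] = s n" for n
    by (induction n) (simp_all add: s)
  ultimately have "\<forall>n. reachable U V \<alpha> \<eta> x0 A (map \<rho> [0..<n])"
    by (simp add: bad_def)
  with finite show False
    by blast
qed

text \<open>
  The tree with root children \<open>B\<close> and with \<open>S n\<close> as the subtree above the child \<open>n\<close>.
\<close>

definition graft :: "nat set \<Rightarrow> (nat \<Rightarrow> nat list set) \<Rightarrow> nat list set" where
  "graft B S = insert [] {n # \<sigma> | n \<sigma>. n \<in> B \<and> \<sigma> \<in> S n}"

lemma graft_simps [simp]: "[] \<in> graft B S" "n # \<sigma> \<in> graft B S \<longleftrightarrow> n \<in> B \<and> \<sigma> \<in> S n"
  by (auto simp: graft_def)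

lemma is_tree_graft:
  assumes "\<And>n. n \<in> B \<Longrightarrow> is_tree (S n)"
  shows "is_tree (graft B S)"
  unfolding is_tree_def
proof (intro conjI ballI allI impI)
  fix \<tau> \<sigma>
  assume "\<tau> \<in> graft B S" and "prefix \<sigma> \<tau>"
  then show "\<sigma> \<in> graft B S"
  proof (cases \<sigma>)
    case (Cons n \<sigma>')
    with \<open>prefix \<sigma> \<tau>\<close> obtain \<tau>' where "\<tau> = n # \<tau>'" and "prefix \<sigma>' \<tau>'"
      by (cases \<tau>) auto
    with Cons \<open>\<tau> \<in> graft B S\<close> assms[of n] show ?thesis
      unfolding is_tree_def by (metis graft_simps(2))
  qed simp
qed simp

lemma branching_graft:
  assumes "B \<in> V" and "\<And>n. n \<in> B \<Longrightarrow> is_tree (S n) \<and> branching V (S n)"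
  shows "branching V (graft B S)"
  unfolding branching_def
proof
  fix \<sigma>
  assume \<sigma>: "\<sigma> \<in> graft B S"
  show "{n. \<sigma> @ [n] \<in> graft B S} \<in> V"
  proof (cases \<sigma>)
    case Nil
    have "{n. [n] \<in> graft B S} = B"
      using assms(2) by (auto simp: is_tree_def)
    with Nil assms(1) show ?thesis
      by simp
  next
    case (Cons m \<tau>)
    with \<sigma> assms(2)[of m] show ?thesis
      by (auto simp: branching_def)
  qed
qed

lemma restr_Suc: "restr p (Suc n) = p 0 # restr (\<lambda>i. p (Suc i)) n"
  unfolding restr_def by (rule map_upt_Suc)

lemma paths_graft:
  assumes "p \<in> paths (graft B S)"
  shows "p 0 \<in> B" and "(\<lambda>i. p (Suc i)) \<in> paths (S (p 0))"
proof -
  have "restr p (Suc n) \<in> graft B S" for n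
    using assms by (simp add: paths_def)
  then show "p 0 \<in> B" and "(\<lambda>i. p (Suc i)) \<in> paths (S (p 0))"
    by (simp_all add: restr_Suc paths_def)
qed

lemma LT_le_imp_LTo_le:
  assumes V: "upper_set V" and le: "LT_le (single_seq U) (seq_sum (fun_seq f) (single_seq V))"
  shows "LTo_le U V"
proof -
  define W where "W = seq_sum (fun_seq f) (single_seq V)"
  obtain \<alpha> \<eta> where win: "winning (single_seq U) W \<alpha> \<eta>"
    using le unfolding LT_le_def W_def by blast
  let ?R = "reachable (single_seq U) W \<alpha> \<eta> 0"
  have tree: "\<exists>T. is_tree T \<and> branching V T \<and>
      (\<forall>p\<in>paths T. \<exists>n. \<exists>c\<in>A. simulate \<alpha> f (arthur_view 0 []) (restr p n) c)"
    if A: "A \<in> U" for A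
  proof (rule play_induct[where P = "\<lambda>h. \<exists>T. is_tree T \<and> branching V T \<and>
      (\<forall>p\<in>paths T. \<exists>n. \<exists>c\<in>A. simulate \<alpha> f (arthur_view 0 h) (restr p n) c)"])
    show "?R A []"
      by (rule reachable.start) (simp_all add: single_seq_def A)
    show "\<not> (\<exists>\<rho>. \<forall>n. ?R A (map \<rho> [0..<n]))"
      using win unfolding winning_def by blast
    fix h
    assume R: "?R A h"
    assume IH: "\<And>r. ?R A (h @ [r]) \<Longrightarrow> \<exists>T. is_tree T \<and> branching V T \<and>
      (\<forall>p\<in>paths T. \<exists>n. \<exists>c\<in>A. simulate \<alpha> f (arthur_view 0 (h @ [r])) (restr p n) c)"
    let ?xs = "arthur_view 0 h"
    consider (out) u where "\<alpha> ?xs = Some (prod_encode (1, u))" "u \<in> A"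
      | (ask) u where "\<alpha> ?xs = Some (prod_encode (0, u))" "legal_query W \<eta> 0 A h u"
      using win R unfolding winning_def by blast
    then show "\<exists>T. is_tree T \<and> branching V T \<and>
      (\<forall>p\<in>paths T. \<exists>n. \<exists>c\<in>A. simulate \<alpha> f ?xs (restr p n) c)"
    proof cases
      \<comment> \<open>The game is over, but the tree must go on branching. Nothing more is read from
        its paths, so the full tree will do.\<close>
      case out
      have "UNIV \<in> V"
        using V unfolding upper_set_def by blast
      then show ?thesis
        using simulate.answer[of \<alpha> ?xs, OF out(1)] out(2)
        by (intro exI[of _ UNIV]) (auto simp: is_tree_def branching_def)
    next
      case ask
      let ?B = "\<eta> 0 A h u"
      have next_pos: "?R A (h @ [(u, ?B, x)])" if "x \<in> ?B" for x
        using reachable.query[OF R ask(1) ask(2) that] .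
      have view: "arthur_view 0 (h @ [(u, B, x)]) = ?xs @ [x]" for B x
        by (simp add: arthur_view_def)
      have "u \<in> dom W"
        using ask(2) by (simp add: legal_query_def)
      then consider (f) k where "u = prod_encode (0, k)" | (V) "u = prod_encode (1, 0)"
        unfolding W_def dom_seq_sum by (auto simp: single_seq_def split: if_splits)
      then show ?thesis
      proof cases
        \<comment> \<open>Nimue's move need not be \<open>{f k}\<close>, but it contains \<open>f k\<close>, so Merlin may give this reply.
          Nothing is read from the path, and the tree stays the same.\<close>
        case f
        then have "f k \<in> ?B"
          using ask(2) by (simp add: legal_query_def W_def seq_sum_left fun_seq_def)
        from IH[OF next_pos[OF this]] show ?thesis
          unfolding view using simulate.query_f ask(1) f by metis
      next
        case V
        have "W u = Some V"
          unfolding V by (simp only: W_def seq_sum_right single_seq_def fun_upd_same)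
        then have B: "?B \<in> V"
          using ask(2) by (simp add: legal_query_def)
        \<comment> \<open>Each reply that Nimue allows has its own tree; these are grafted onto her move.\<close>
        have "\<forall>x\<in>?B. \<exists>T. is_tree T \<and> branching V T \<and>
            (\<forall>p\<in>paths T. \<exists>n. \<exists>c\<in>A. simulate \<alpha> f (?xs @ [x]) (restr p n) c)"
          using IH[OF next_pos] unfolding view by blast
        then obtain S where S: "\<And>x. x \<in> ?B \<Longrightarrow> is_tree (S x) \<and> branching V (S x) \<and>
            (\<forall>p\<in>paths (S x). \<exists>n. \<exists>c\<in>A. simulate \<alpha> f (?xs @ [x]) (restr p n) c)"
          by metis
        have "\<exists>n. \<exists>c\<in>A. simulate \<alpha> f ?xs (restr p n) c"
          if p: "p \<in> paths (graft ?B S)" for p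
        proof -
          obtain n c where "c \<in> A" "simulate \<alpha> f (?xs @ [p 0]) (restr (\<lambda>i. p (Suc i)) n) c"
            using S paths_graft[OF p] by blast
          then have "simulate \<alpha> f ?xs (restr p (Suc n)) c"
            unfolding restr_Suc using ask(1) V by (intro simulate.query_V[of \<alpha> ?xs]) simp_all
          with \<open>c \<in> A\<close> show ?thesis
            by blast
        qed
        then show ?thesis
          using is_tree_graft[of ?B S] branching_graft[OF B, of S] S by blast
      qed
    qed
  qed
  show ?thesis
    unfolding LTo_le_def
  proof (intro exI[of _ "simulation_map \<alpha> f"] conjI ballI partial_continuous_simulation_map)
    fix A
    assume "A \<in> U"
    from tree[OF this] obtain T where T: "is_tree T" "branching V T"
      and p: "\<And>p. p \<in> paths T \<Longrightarrow> \<exists>c\<in>A. simulation_map \<alpha> f p = Some c"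
      unfolding simulation_map_eq_Some arthur_view_def by fastforce
    have "paths T \<subseteq> dom (simulation_map \<alpha> f)"
      using p by blast
    moreover have "\<forall>p\<in>paths T. the (simulation_map \<alpha> f p) \<in> A"
      using p by fastforce
    ultimately show "\<exists>T. is_tree T \<and> branching V T \<and> paths T \<subseteq> dom (simulation_map \<alpha> f) \<and>
        (\<forall>p\<in>paths T. the (simulation_map \<alpha> f p) \<in> A)"
      using T by blast
  qed
qed

theorem theoremD:
  fixes U V :: "nat set set"
  assumes "upper_set U" and "upper_set V"
  shows "LTo_le U V \<longleftrightarrow>
    (\<exists>f :: nat \<Rightarrow> nat. LT_le (single_seq U) (seq_sum (fun_seq f) (single_seq V)))"
  using LTo_le_imp_LT_le[OF assms(2)] LT_le_imp_LTo_le[OF assms(2)] by blast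

end
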